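(* Suppose that Problem $(\mathcal{SP})$ is non-degenerate, and let $\bar{x}\in\mathcal{X}_a$. Then $\bar{x}$ is the unique solution (global minimizer) of Problem $(\mathcal{P})$ if and only if there exists $\bar{\varsigma}\in\mathcal{S}_a^+$ such that $(\bar{x},\bar{\varsigma})$ is a solution (saddle point) of Problem $(\mathcal{SP})$.
   Context: Data. $\mathcal{X}_a$ is either $\mathbb{R}^n$ or a subset of $\mathbb{R}^n$ defined by linear constraints; $A\in\mathbb{R}^{n\times n}$ is symmetric; $f\in\mathbb{R}^n$; $\langle\cdot,\cdot\rangle$ is the standard inner product. $A_1,\dots,A_m\in\mathbb{R}^{n\times n}$ are symmetric, $b_1,\dots,b_m\in\mathbb{R}^n$, and $\Lambda:\mathcal{X}_a\to\mathcal{V}_a\subset\mathbb{R}^m$ is the quadratic map with components $\Lambda_k(x)=\frac12\langle x,A_kx\rangle-\langle x,b_k\rangle$, $k=1,\dots,m$. Canonical function. $V:\mathcal{V}_a\to\mathbb{R}$ is strictly convex and differentiable, and $\nabla V:\mathcal{V}_a\to\mathcal{V}_a^*\subset\mathbb{R}^m$ is invertible. Its Legendre conjugate $V^*:\mathcal{V}_a^*\to\mathbb{R}$ satisfies, on $\mathcal{V}_a\times\mathcal{V}_a^*$, $\varsigma=\nabla V(\xi)\Leftrightarrow\xi=\nabla V^*(\varsigma)\Leftrightarrow V(\xi)+V^*(\varsigma)=\langle\xi,\varsigma\rangle$, and $V(\Lambda(x))=\max\{\langle\Lambda(x),\varsigma\rangle-V^*(\varsigma):\varsigma\in\mathcal{V}_a^*\}$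 for $x\in\mathcal{X}_a$. The sets $\mathcal{V}_a,\mathcal{V}_a^*$ are convex and $V^*$ is strictly convex. Primal problem $(\mathcal{P})$: minimize $P(x)=V(\Lambda(x))+\frac12\langle x,Ax\rangle-\langle x,f\rangle$ over $x\in\mathcal{X}_a$. Notation. $G(\varsigma)=A+\sum_{k=1}^m\varsigma_kA_k$, $\tau(\varsigma)=f+\sum_{k=1}^m\varsigma_kb_k$, $\mathcal{S}_a^+=\{\varsigma\in\mathcal{V}_a^*: G(\varsigma)\succeq0\}$, and $\Xi(x,\varsigma)=\frac12\langle x,G(\varsigma)x\rangle-V^*(\varsigma)-\langle x,\tau(\varsigma)\rangle$. Saddle point problem $(\mathcal{SP})$: $\min_{x}\max_{\varsigma}\{\Xi(x,\varsigma):(x,\varsigma)\in\mathcal{X}_a\times\mathcal{S}_a^+\}$. A solution (saddle point) is a pair $(\bar x,\bar\varsigma)\in\mathcal{X}_a\times\mathcal{S}_a^+$ with $\Xi(\bar x,\varsigma)\le\Xi(\bar x,\bar\varsigma)\le\Xi(x,\bar\varsigma)$ for all $(x,\varsigma)\in\mathcal{X}_a\times\mathcal{S}_a^+$. Standing assumption: there is an optimal solution $x^*$ of $(\mathcal{P})$ with $G(\nabla V(\Lambda(x^* )))\succeq0$. Non-degeneracy: $(\mathcal{SP})$ is called non-degenerate if it has a saddle point $(\bar x,\bar\varsigma)$ with $\det G(\bar\varsigma)\ne0$; if it has a saddle point $(\bar x,\bar\varsigma)$ with $\det G(\bar\varsigma)=0$, it is called degenerate. *)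

theory Defs
  imports "HOL-Analysis.Analysis"
begin

definition strictly_convex_on :: "'a::real_vector set \<Rightarrow> ('a \<Rightarrow> real) \<Rightarrow> bool" where
  "strictly_convex_on S f \<longleftrightarrow> convex S \<and>
     (\<forall>x\<in>S. \<forall>y\<in>S. \<forall>t. x \<noteq> y \<longrightarrow> 0 < t \<longrightarrow> t < 1 \<longrightarrow>
        f ((1 - t) *\<^sub>R x + t *\<^sub>R y) < (1 - t) * f x + t * f y)"

(* Differentiability is relative to S, which need not be open. Where S has empty interior the
   gradient is not unique, so it is a selected function g and not a description. *)
definition gradient_on :: "'a::real_inner set \<Rightarrow> ('a \<Rightarrow> real) \<Rightarrow> ('a \<Rightarrow> 'a) \<Rightarrow> bool" where
  "gradient_on S f g \<longleftrightarrow>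
     (\<forall>x\<in>S. (f has_derivative (\<lambda>h. g x \<bullet> h)) (at x within S))"

definition pos_semidef :: "real^'n^'n \<Rightarrow> bool" where
  "pos_semidef M \<longleftrightarrow> transpose M = M \<and> (\<forall>x. 0 \<le> x \<bullet> (M *v x))"

definition Lam :: "('m \<Rightarrow> real^'n^'n) \<Rightarrow> ('m \<Rightarrow> real^'n) \<Rightarrow> real^'n \<Rightarrow> real^'m" where
  "Lam Am b x = (\<chi> k. (1/2) * (x \<bullet> (Am k *v x)) - x \<bullet> b k)"

definition primal :: "real^'n^'n \<Rightarrow> real^'n \<Rightarrow> ('m \<Rightarrow> real^'n^'n) \<Rightarrow> ('m \<Rightarrow> real^'n) \<Rightarrow>
    (real^'m \<Rightarrow> real) \<Rightarrow> real^'n \<Rightarrow> real" where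
  "primal A f Am b V x = V (Lam Am b x) + (1/2) * (x \<bullet> (A *v x)) - x \<bullet> f"

definition G :: "real^'n^'n \<Rightarrow> ('m::finite \<Rightarrow> real^'n^'n) \<Rightarrow> real^'m \<Rightarrow> real^'n^'n" where
  "G A Am s = A + (\<Sum>k\<in>UNIV. (s $ k) *\<^sub>R Am k)"

definition tau :: "real^'n \<Rightarrow> ('m::finite \<Rightarrow> real^'n) \<Rightarrow> real^'m \<Rightarrow> real^'n" where
  "tau f b s = f + (\<Sum>k\<in>UNIV. (s $ k) *\<^sub>R b k)"

definition Sa_plus :: "real^'n^'n \<Rightarrow> ('m::finite \<Rightarrow> real^'n^'n) \<Rightarrow> (real^'m) set \<Rightarrow> (real^'m) set" where
  "Sa_plus A Am Vas = {s \<in> Vas. pos_semidef (G A Am s)}"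

definition Xi :: "real^'n^'n \<Rightarrow> real^'n \<Rightarrow> ('m::finite \<Rightarrow> real^'n^'n) \<Rightarrow> ('m \<Rightarrow> real^'n) \<Rightarrow>
    (real^'m \<Rightarrow> real) \<Rightarrow> real^'n \<Rightarrow> real^'m \<Rightarrow> real" where
  "Xi A f Am b Vs x s = (1/2) * (x \<bullet> (G A Am s *v x)) - Vs s - x \<bullet> tau f b s"

definition saddle_point :: "'a set \<Rightarrow> 'b set \<Rightarrow> ('a \<Rightarrow> 'b \<Rightarrow> real) \<Rightarrow> 'a \<Rightarrow> 'b \<Rightarrow> bool" where
  "saddle_point X S F x0 s0 \<longleftrightarrow> x0 \<in> X \<and> s0 \<in> S \<and>
     (\<forall>x\<in>X. \<forall>s\<in>S. F x0 s \<le> F x0 s0 \<and> F x0 s0 \<le> F x s0)"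

definition SP_solution :: "real^'n^'n \<Rightarrow> real^'n \<Rightarrow> ('m::finite \<Rightarrow> real^'n^'n) \<Rightarrow> ('m \<Rightarrow> real^'n) \<Rightarrow>
    (real^'m \<Rightarrow> real) \<Rightarrow> (real^'n) set \<Rightarrow> (real^'m) set \<Rightarrow> real^'n \<Rightarrow> real^'m \<Rightarrow> bool" where
  "SP_solution A f Am b Vs Xa Vas = saddle_point Xa (Sa_plus A Am Vas) (Xi A f Am b Vs)"

definition SP_nondegenerate :: "real^'n^'n \<Rightarrow> real^'n \<Rightarrow> ('m::finite \<Rightarrow> real^'n^'n) \<Rightarrow> ('m \<Rightarrow> real^'n) \<Rightarrow>
    (real^'m \<Rightarrow> real) \<Rightarrow> (real^'n) set \<Rightarrow> (real^'m) set \<Rightarrow> bool" where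
  "SP_nondegenerate A f Am b Vs Xa Vas \<longleftrightarrow>
     (\<exists>x s. SP_solution A f Am b Vs Xa Vas x s \<and> det (G A Am s) \<noteq> 0)"

end

theory Submission
  imports Defs
begin

text \<open>
  Fenchel duality turns the nonconvex objective \<open>primal\<close> into the upper envelope of the functions
  \<open>Xi _ s\<close>, each of which is quadratic with Hessian \<open>G A Am s\<close>; the envelope is attained at the
  dual point \<open>gradV (Lam Am b x)\<close>.  At a minimizer of the primal problem whose dual point makes
  \<open>G A Am s\<close> positive semidefinite, the touching quadratic has the same directional derivatives
  as \<open>primal\<close>, so first-order optimality passes from \<open>primal\<close> to the convex function
  \<open>Xi _ s\<close>, for which it is sufficient.  Hence the minimizer and its dual point form a saddle
  point (\<open>primal_minimizer_gives_saddle_point\<close>).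

  Saddle points can be recombined: if \<open>(x\<^sub>0, s\<^sub>0)\<close> is the nondegenerate one and \<open>(x, s)\<close> is any
  other, then \<open>x\<close> also minimizes \<open>Xi _ s\<^sub>0\<close>.  A positive semidefinite matrix of nonzero
  determinant is positive definite, so \<open>Xi _ s\<^sub>0\<close> has only one minimizer, and therefore all saddle
  points share the first component \<open>x\<^sub>0\<close>.  In particular \<open>x\<^sub>0\<close> solves the primal problem, and since
  \<open>primal\<close> lies above \<open>Xi _ s\<^sub>0\<close> with equality of the two minimal values, no other point does.
  Both sides of the equivalence thus say that \<open>xbar\<close> is this one point \<open>x\<^sub>0\<close>.
\<close>

section \<open>Quadratic functions\<close>

lemma quadratic_form_expand:
  fixes M :: "real^'n^'n"
  assumes "transpose M = M"
  shows "(x + t *\<^sub>R h) \<bullet> (M *v (x + t *\<^sub>R h)) =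
         x \<bullet> (M *v x) + 2 * t * (h \<bullet> (M *v x)) + t\<^sup>2 * (h \<bullet> (M *v h))"
proof -
  have "x \<bullet> (M *v h) = h \<bullet> (M *v x)"
    using dot_lmul_matrix[of x M h] assms
    by (metis inner_commute transpose_matrix_vector)
  then show ?thesis
    by (simp add: matrix_vector_right_distrib matrix_vector_mult_scaleR inner_add_left
        inner_add_right algebra_simps power2_eq_square)
qed

text \<open>
  A vector on which a nonnegative form vanishes minimizes the form, so the gradient \<open>2 M x\<close>
  vanishes there; a nonsingular \<open>M\<close> then forces the vector to be zero.
\<close>

lemma pos_semidef_nonsingular_pos:
  fixes M :: "real^'n^'n"
  assumes psd: "pos_semidef M" and det: "det M \<noteq> 0" and "x \<noteq> 0"
  shows "0 < x \<bullet> (M *v x)"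
proof (rule ccontr)
  assume "\<not> 0 < x \<bullet> (M *v x)"
  with psd have x0: "x \<bullet> (M *v x) = 0"
    unfolding pos_semidef_def by (metis less_eq_real_def)
  define v where "v = M *v x"
  define c where "c = v \<bullet> (M *v v)"
  have c: "0 \<le> c" using psd by (simp add: c_def pos_semidef_def)
  have form: "0 \<le> 2 * t * (v \<bullet> v) + t\<^sup>2 * c" for t
    using psd quadratic_form_expand[of M x t v] x0
    unfolding pos_semidef_def c_def v_def by (metis add_0)
  have "v \<bullet> v = 0"
  proof (rule ccontr)
    assume "v \<bullet> v \<noteq> 0"
    then have vv: "0 < v \<bullet> v" by simp
    \<comment> \<open>The parabola in \<open>form\<close> has its vertex at \<open>- (v \<bullet> v) / c\<close>; the slightly shorter step with
       \<open>c + 1\<close> also makes it negative and covers the case \<open>c = 0\<close>.\<close>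
    define t where "t = - (v \<bullet> v) / (c + 1)"
    have "t * (c + 1) = - (v \<bullet> v)" using c by (simp add: t_def)
    then have tc: "t * c = - (v \<bullet> v) - t" by (simp add: distrib_left)
    have "2 * t * (v \<bullet> v) + t\<^sup>2 * c = 2 * t * (v \<bullet> v) + t * (t * c)"
      by (simp add: power2_eq_square)
    also have "\<dots> = t * (v \<bullet> v) - t\<^sup>2"
      unfolding tc by (simp add: power2_eq_square right_diff_distrib)
    finally have "2 * t * (v \<bullet> v) + t\<^sup>2 * c = t * (v \<bullet> v) - t\<^sup>2" .
    moreover have "t * (v \<bullet> v) < 0" using vv c
      by (simp add: t_def divide_neg_pos mult_neg_pos)
    ultimately show False using form[of t] zero_le_power2[of t] by linarith
  qed
  then have "M *v x = 0" by (simp add: v_def)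
  moreover have "inj ((*v) M)"
    using det invertible_det_nz inj_matrix_vector_mult by blast
  ultimately show False using \<open>x \<noteq> 0\<close>
    by (metis injD matrix_vector_mult_0_right)
qed

text \<open>
  A second minimizer would make the midpoint strictly better than both, by positive definiteness.
  Since \<open>X\<close> may have boundary, \<open>x\<close> need not be a critical point, and the midpoint takes the place
  of a vanishing gradient.
\<close>

lemma quadratic_minimizer_strict:
  fixes M :: "real^'n^'n" and c :: "real^'n"
  defines "q \<equiv> \<lambda>x. (1/2) * (x \<bullet> (M *v x)) - x \<bullet> c"
  assumes "convex X" "pos_semidef M" "det M \<noteq> 0"
    and x: "x \<in> X" and y: "y \<in> X" and "y \<noteq> x"
    and min: "\<And>z. z \<in> X \<Longrightarrow> q x \<le> q z"
  shows "q x < q y"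
proof -
  define h where "h = y - x"
  have sym: "transpose M = M" using assms(3) by (simp add: pos_semidef_def)
  have pos: "0 < h \<bullet> (M *v h)"
    using pos_semidef_nonsingular_pos[OF assms(3,4)] \<open>y \<noteq> x\<close> by (simp add: h_def)
  have ex: "q (x + t *\<^sub>R h) = q x + t * (h \<bullet> (M *v x) - h \<bullet> c) + t\<^sup>2 / 2 * (h \<bullet> (M *v h))" for t
    unfolding q_def quadratic_form_expand[OF sym]
    by (simp add: inner_add_left field_simps)
  have "x + (1/2) *\<^sub>R h = (1/2) *\<^sub>R x + (1/2) *\<^sub>R y"
    by (simp add: h_def vec_eq_iff field_simps)
  then have "x + (1/2) *\<^sub>R h \<in> X"
    using convexD[OF \<open>convex X\<close> x y, of "1/2" "1/2"] by simp
  from min[OF this] have "0 \<le> (1/2) * (h \<bullet> (M *v x) - h \<bullet> c) + (1/8) * (h \<bullet> (M *v h))"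
    by (simp add: ex power2_eq_square)
  moreover have "q y = q x + (h \<bullet> (M *v x) - h \<bullet> c) + (1/2) * (h \<bullet> (M *v h))"
    using ex[of 1] by (simp add: h_def)
  ultimately show ?thesis using pos by (simp add: field_simps)
qed

section \<open>Recombination of saddle points\<close>

lemma saddle_point_value_eq:
  assumes "saddle_point X S F x0 s0" "saddle_point X S F x1 s1"
  shows "F x0 s0 = F x1 s1"
  using assms unfolding saddle_point_def by (metis order.antisym order.trans)

text \<open>
  \<open>F x1 s0\<close> lies between \<open>F x0 s0\<close> and \<open>F x1 s1\<close>, which are the same number.
\<close>

lemma saddle_point_interchange:
  assumes "saddle_point X S F x0 s0" "saddle_point X S F x1 s1"
  shows "saddle_point X S F x1 s0"
proof -
  have "F x1 s0 = F x0 s0" "F x0 s0 = F x1 s1"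
    using assms saddle_point_value_eq[OF assms] unfolding saddle_point_def
    by (metis order.antisym)+
  then show ?thesis using assms unfolding saddle_point_def by metis
qed

section \<open>The total complementary function\<close>

lemma inner_G:
  "x \<bullet> (G A Am s *v y) = x \<bullet> (A *v y) + (\<Sum>k\<in>UNIV. s $ k * (x \<bullet> (Am k *v y)))"
proof -
  have "(\<Sum>k\<in>K. s $ k *\<^sub>R Am k) *v y = (\<Sum>k\<in>K. s $ k *\<^sub>R (Am k *v y))" if "finite K" for K
    using that
    by (induction K) (simp_all add: matrix_vector_mult_add_rdistrib scaleR_matrix_vector_assoc)
  then show ?thesis
    by (simp add: G_def matrix_vector_mult_add_rdistrib inner_add_right inner_sum_right)
qed

lemma inner_tau: "x \<bullet> tau f b s = x \<bullet> f + (\<Sum>k\<in>UNIV. s $ k * (x \<bullet> b k))"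
  by (simp add: tau_def inner_add_right inner_sum_right)

text \<open>
  Grouping the total complementary function by the components of \<open>Lam\<close> exhibits it as the
  Fenchel lower estimate of \<open>primal\<close> at the dual point \<open>s\<close>.
\<close>

lemma Xi_eq_Lam:
  "Xi A f Am b Vs x s = (Lam Am b x \<bullet> s - Vs s) + (1/2) * (x \<bullet> (A *v x)) - x \<bullet> f"
proof -
  have "Lam Am b x \<bullet> s = (1/2) * (\<Sum>k\<in>UNIV. s $ k * (x \<bullet> (Am k *v x)))
      - (\<Sum>k\<in>UNIV. s $ k * (x \<bullet> b k))"
    by (simp add: Lam_def inner_vec_def sum_distrib_left sum_subtractf[symmetric] algebra_simps)
  then show ?thesis
    by (simp add: Xi_def inner_G inner_tau algebra_simps)
qed

lemma Lam_expand:
  fixes Am :: "'m::finite \<Rightarrow> real^'n^'n"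
  assumes "\<And>k. transpose (Am k) = Am k"
  shows "Lam Am b (x + t *\<^sub>R h) = Lam Am b x + t *\<^sub>R (\<chi> k. h \<bullet> (Am k *v x) - h \<bullet> b k)
           + t\<^sup>2 *\<^sub>R (\<chi> k. (1/2) * (h \<bullet> (Am k *v h)))"
  unfolding vec_eq_iff Lam_def quadratic_form_expand[OF assms]
  by (simp add: inner_add_left field_simps)

section \<open>From primal minimizers to saddle points\<close>

text \<open>
  The chain rule identifies the slope of \<open>primal\<close> at \<open>x\<close> towards another feasible point with the
  slope of the quadratic \<open>Xi _ s\<close> for the dual point \<open>s\<close> of \<open>x\<close>.  Only one-sided differentiability
  is available, because \<open>V\<close> is differentiable relative to \<open>Va\<close> and \<open>Va\<close> may have empty interior.
\<close>

lemma primal_segment_derivative: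
  fixes Am :: "'m::finite \<Rightarrow> real^'n^'n" and V :: "real^'m \<Rightarrow> real"
  assumes symA: "transpose A = A" and symAm: "\<And>k. transpose (Am k) = Am k"
    and "convex X" and Lam: "Lam Am b ` X \<subseteq> Va" and grad: "gradient_on Va V gradV"
    and x: "x \<in> X" and y: "y \<in> X"
  defines "s \<equiv> gradV (Lam Am b x)"
  shows "((\<lambda>t. primal A f Am b V (x + t *\<^sub>R (y - x))) has_real_derivative
           ((y - x) \<bullet> (G A Am s *v x) - (y - x) \<bullet> tau f b s)) (at 0 within {0..1})"
proof -
  define h where "h = y - x"
  define L where "L = (\<chi> k. h \<bullet> (Am k *v x) - h \<bullet> b k)"
  define p where "p = (\<lambda>t. Lam Am b (x + t *\<^sub>R h))"
  have "x + t *\<^sub>R h \<in> X" if "t \<in> {0..1}" for t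
    using convexD_alt[OF \<open>convex X\<close> x y, of t] that by (simp add: h_def algebra_simps)
  then have p_Va: "p ` {0..1} \<subseteq> Va" using Lam by (auto simp: p_def)
  have p_deriv: "(p has_derivative (\<lambda>r. r *\<^sub>R L)) (at 0 within {0..1})"
    unfolding p_def Lam_expand[OF symAm] L_def
    by (auto intro!: derivative_eq_intros)
  have "p 0 = Lam Am b x" by (simp add: p_def)
  moreover have "Lam Am b x \<in> Va" using Lam x by blast
  ultimately have "(V has_derivative (\<lambda>r. s \<bullet> r)) (at (p 0) within p ` {0..1})"
    using grad has_derivative_subset[OF _ p_Va] by (auto simp: gradient_on_def s_def)
  from diff_chain_within[OF p_deriv this]
  have "((\<lambda>t. V (p t)) has_real_derivative s \<bullet> L) (at 0 within {0..1})"
    by (simp add: has_field_derivative_def o_def mult_commute_abs)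
  then have "((\<lambda>t. V (p t) + (1/2) * (x \<bullet> (A *v x) + 2 * t * (h \<bullet> (A *v x)) + t\<^sup>2 * (h \<bullet> (A *v h)))
         - (x \<bullet> f + t * (h \<bullet> f))) has_real_derivative s \<bullet> L + h \<bullet> (A *v x) - h \<bullet> f)
         (at 0 within {0..1})"
    by (auto intro!: derivative_eq_intros)
  moreover have "s \<bullet> L + h \<bullet> (A *v x) - h \<bullet> f = h \<bullet> (G A Am s *v x) - h \<bullet> tau f b s"
    by (simp add: inner_G inner_tau L_def inner_vec_def[of s] sum_subtractf right_diff_distrib)
  moreover have "primal A f Am b V (x + t *\<^sub>R h) =
      V (p t) + (1/2) * (x \<bullet> (A *v x) + 2 * t * (h \<bullet> (A *v x)) + t\<^sup>2 * (h \<bullet> (A *v h)))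
         - (x \<bullet> f + t * (h \<bullet> f))" for t
    unfolding primal_def p_def quadratic_form_expand[OF symA] by (simp add: inner_add_left)
  ultimately show ?thesis by (simp add: h_def)
qed

text \<open>
  Local optimality of \<open>x\<close> for \<open>primal\<close> makes the slope of the touching quadratic \<open>Xi _ s\<close>
  nonnegative in every feasible direction; positive semidefiniteness of its Hessian turns this into
  global optimality for \<open>Xi _ s\<close>.
\<close>

lemma primal_minimizer_minimizes_Xi:
  fixes Am :: "'m::finite \<Rightarrow> real^'n^'n" and V :: "real^'m \<Rightarrow> real"
  assumes symA: "transpose A = A" and symAm: "\<And>k. transpose (Am k) = Am k"
    and "convex X" and Lam: "Lam Am b ` X \<subseteq> Va" and grad: "gradient_on Va V gradV"
    and min: "is_arg_min (primal A f Am b V) (\<lambda>x. x \<in> X) x"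
    and psd: "pos_semidef (G A Am (gradV (Lam Am b x)))"
    and y: "y \<in> X"
  shows "Xi A f Am b Vs x (gradV (Lam Am b x)) \<le> Xi A f Am b Vs y (gradV (Lam Am b x))"
proof -
  define s where "s = gradV (Lam Am b x)"
  define h where "h = y - x"
  define d where "d = h \<bullet> (G A Am s *v x) - h \<bullet> tau f b s"
  have x: "x \<in> X" and le: "\<And>z. z \<in> X \<Longrightarrow> primal A f Am b V x \<le> primal A f Am b V z"
    using min by (auto simp: is_arg_min_linorder)
  have deriv: "((\<lambda>t. primal A f Am b V (x + t *\<^sub>R h)) has_real_derivative d) (at 0 within {0..1})"
    using primal_segment_derivative[OF symA symAm \<open>convex X\<close> Lam grad x y, where f=f]
    by (simp add: d_def h_def s_def)
  have "0 \<le> d"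
  proof (rule ccontr)
    assume "\<not> 0 \<le> d"
    then obtain e where e: "0 < e"
      and dec: "\<And>t. 0 < t \<Longrightarrow> t \<in> {0..1} \<Longrightarrow> t < e \<Longrightarrow>
            primal A f Am b V (x + t *\<^sub>R h) < primal A f Am b V x"
      using has_real_derivative_neg_dec_right[OF deriv] by auto
    define t where "t = min 1 (e / 2)"
    have t: "0 < t" "t \<in> {0..1}" "t < e" using e by (auto simp: t_def)
    have "x + t *\<^sub>R h \<in> X"
      using convexD_alt[OF \<open>convex X\<close> x y, of t] t by (simp add: h_def algebra_simps)
    then show False using le dec[OF t] by (meson not_le)
  qed
  moreover have "0 \<le> h \<bullet> (G A Am s *v h)"
    using psd by (simp add: pos_semidef_def s_def)
  moreover have "Xi A f Am b Vs y s = Xi A f Am b Vs x s + d + (1/2) * (h \<bullet> (G A Am s *v h))"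
  proof -
    have "transpose (G A Am s) = G A Am s" using psd by (simp add: pos_semidef_def s_def)
    from quadratic_form_expand[OF this, of x 1 h] show ?thesis
      by (simp add: Xi_def d_def h_def inner_diff_left algebra_simps)
  qed
  ultimately show ?thesis by (simp add: s_def)
qed

lemma primal_minimizer_gives_saddle_point:
  fixes Am :: "'m::finite \<Rightarrow> real^'n^'n" and V :: "real^'m \<Rightarrow> real"
  assumes symA: "transpose A = A" and symAm: "\<And>k. transpose (Am k) = Am k"
    and "convex X" and Lam: "Lam Am b ` X \<subseteq> Va" and grad: "gradient_on Va V gradV"
    and min: "is_arg_min (primal A f Am b V) (\<lambda>x. x \<in> X) x"
    and psd: "pos_semidef (G A Am (gradV (Lam Am b x)))"
    and dual: "gradV (Lam Am b x) \<in> Vas"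
    and upper: "\<And>s. s \<in> Vas \<Longrightarrow> Xi A f Am b Vs x s \<le> primal A f Am b V x"
    and attained: "Xi A f Am b Vs x (gradV (Lam Am b x)) = primal A f Am b V x"
  shows "SP_solution A f Am b Vs X Vas x (gradV (Lam Am b x))"
proof -
  have "Xi A f Am b Vs x (gradV (Lam Am b x)) \<le> Xi A f Am b Vs y (gradV (Lam Am b x))"
    if "y \<in> X" for y
    using that
    by (rule primal_minimizer_minimizes_Xi[OF symA symAm \<open>convex X\<close> Lam grad min psd])
  moreover have "x \<in> X" using min by (simp add: is_arg_min_def)
  ultimately show ?thesis
    using psd dual upper attained by (simp add: SP_solution_def saddle_point_def Sa_plus_def)
qed

section \<open>Uniqueness in the nondegenerate case\<close>

lemma nondegenerate_saddle_point_strict: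
  assumes "convex X" and sad: "SP_solution A f Am b Vs X Vas x s"
    and det: "det (G A Am s) \<noteq> 0" and "y \<in> X" "y \<noteq> x"
  shows "Xi A f Am b Vs x s < Xi A f Am b Vs y s"
proof -
  have "x \<in> X" "pos_semidef (G A Am s)"
    and "\<And>z. z \<in> X \<Longrightarrow> Xi A f Am b Vs x s \<le> Xi A f Am b Vs z s"
    using sad by (auto simp: SP_solution_def saddle_point_def Sa_plus_def)
  then show ?thesis
    using quadratic_minimizer_strict[OF \<open>convex X\<close> _ det, of x y "tau f b s"] assms
    by (simp add: Xi_def)
qed

theorem theorem2:
  fixes Xa :: "(real^'n) set"
    and A :: "real^'n^'n" and f :: "real^'n"
    and Am :: "'m::finite \<Rightarrow> real^'n^'n" and b :: "'m \<Rightarrow> real^'n"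
    and Va Vas :: "(real^'m) set"
    and V Vs :: "real^'m \<Rightarrow> real"
    and gradV gradVs :: "real^'m \<Rightarrow> real^'m"
    and xbar :: "real^'n"
  assumes "polyhedron Xa"
    and "transpose A = A"
    and "\<And>k. transpose (Am k) = Am k"
    and "Lam Am b ` Xa \<subseteq> Va"
    and "convex Va" and "convex Vas"
    and "strictly_convex_on Va V"
    and "gradient_on Va V gradV"
    and "bij_betw gradV Va Vas"
    and "strictly_convex_on Vas Vs"
    and "gradient_on Vas Vs gradVs"
    and "\<And>xi s. xi \<in> Va \<Longrightarrow> s \<in> Vas \<Longrightarrow>
           (s = gradV xi \<longleftrightarrow> xi = gradVs s) \<and>
           (xi = gradVs s \<longleftrightarrow> V xi + Vs s = xi \<bullet> s)"
    and "\<And>x. x \<in> Xa \<Longrightarrow>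
           (\<exists>s\<in>Vas. V (Lam Am b x) = Lam Am b x \<bullet> s - Vs s) \<and>
           (\<forall>s\<in>Vas. Lam Am b x \<bullet> s - Vs s \<le> V (Lam Am b x))"
    and "\<exists>xstar. is_arg_min (primal A f Am b V) (\<lambda>x. x \<in> Xa) xstar \<and>
           pos_semidef (G A Am (gradV (Lam Am b xstar)))"
    and "SP_nondegenerate A f Am b Vs Xa Vas"
    and "xbar \<in> Xa"
  shows "(is_arg_min (primal A f Am b V) (\<lambda>x. x \<in> Xa) xbar \<and>
           (\<forall>y. is_arg_min (primal A f Am b V) (\<lambda>x. x \<in> Xa) y \<longrightarrow> y = xbar)) \<longleftrightarrow>
         (\<exists>sbar\<in>Sa_plus A Am Vas. SP_solution A f Am b Vs Xa Vas xbar sbar)"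
proof -
  note symA = assms(2) and symAm = assms(3) and Lam = assms(4) and grad = assms(8)
    and legendre = assms(12) and fenchel = assms(13)
  let ?P = "primal A f Am b V" and ?Xi = "Xi A f Am b Vs"
  have cvx: "convex Xa" using assms(1) by (rule polyhedron_imp_convex)
  have upper: "?Xi x s \<le> ?P x" if "x \<in> Xa" "s \<in> Vas" for x s
    using fenchel[OF that(1)] that(2) by (simp add: Xi_eq_Lam primal_def)
  have dual: "gradV (Lam Am b x) \<in> Vas" if "x \<in> Xa" for x
    using that Lam assms(9) by (meson bij_betwE image_subset_iff)
  have attained: "?Xi x (gradV (Lam Am b x)) = ?P x" if "x \<in> Xa" for x
  proof -
    have "Lam Am b x \<in> Va" using Lam that by blast
    from legendre[OF this dual[OF that]] show ?thesis
      by (auto simp: Xi_eq_Lam primal_def)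
  qed

  obtain xs where min: "is_arg_min ?P (\<lambda>x. x \<in> Xa) xs"
    and psd: "pos_semidef (G A Am (gradV (Lam Am b xs)))"
    using assms(14) by blast
  define ss where "ss = gradV (Lam Am b xs)"
  have xs: "xs \<in> Xa" using min by (simp add: is_arg_min_def)
  have sad: "SP_solution A f Am b Vs Xa Vas xs ss"
    unfolding ss_def
    by (rule primal_minimizer_gives_saddle_point[OF symA symAm cvx Lam grad min psd
          dual[OF xs] upper[OF xs] attained[OF xs]])

  obtain x0 s0 where sad0: "SP_solution A f Am b Vs Xa Vas x0 s0"
    and det: "det (G A Am s0) \<noteq> 0"
    using assms(15) by (auto simp: SP_nondegenerate_def)
  have x0: "x0 \<in> Xa" and s0: "s0 \<in> Vas"
    using sad0 by (auto simp: SP_solution_def saddle_point_def Sa_plus_def)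
  have all_x0: "x = x0" if "SP_solution A f Am b Vs Xa Vas x s" for x s
  proof (rule ccontr)
    assume "x \<noteq> x0"
    have sad': "SP_solution A f Am b Vs Xa Vas x s0"
      using sad0 that unfolding SP_solution_def by (rule saddle_point_interchange)
    then have "x \<in> Xa" by (simp add: SP_solution_def saddle_point_def)
    with \<open>x \<noteq> x0\<close> show False
      using nondegenerate_saddle_point_strict[OF cvx sad0 det, of x]
        nondegenerate_saddle_point_strict[OF cvx sad' det x0] by simp
  qed
  then have xs_x0: "xs = x0" using sad by blast
  have unique: "y = x0" if "is_arg_min ?P (\<lambda>x. x \<in> Xa) y" for y
  proof (rule ccontr)
    assume "y \<noteq> x0"
    have y: "y \<in> Xa" using that by (simp add: is_arg_min_def)
    have "?P x0 = ?Xi xs ss" using attained[OF xs] by (simp add: xs_x0[symmetric] ss_def)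
    also have "\<dots> = ?Xi x0 s0"
      using sad sad0 unfolding SP_solution_def by (rule saddle_point_value_eq)
    also have "\<dots> < ?Xi y s0"
      by (rule nondegenerate_saddle_point_strict[OF cvx sad0 det y \<open>y \<noteq> x0\<close>])
    also have "\<dots> \<le> ?P y" by (rule upper[OF y s0])
    finally show False using that x0 by (auto simp: is_arg_min_def)
  qed
  have "ss \<in> Sa_plus A Am Vas"
    using sad by (simp add: SP_solution_def saddle_point_def)
  then show ?thesis
    using all_x0 unique min sad xs_x0 by blast
qed

end
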